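(* The first eigenvalue $\lambda(p)$ and its derivative $\lambda'(p)$ with respect to $p$ satisfy $$\lim_{p\to 1+0}\lambda(p)=1,\qquad \lim_{p\to 1+0}\lambda'(p)=\infty,$$ $$\lim_{p\to\infty}(\lambda(p)-p)=\frac{\pi^2}{6}-1,\qquad \lim_{p\to\infty}\lambda'(p)=1.$$
   Context: For $1<p<\infty$, $\lambda(p)$ denotes the first (smallest) eigenvalue of the one-dimensional $p$-Laplacian on $(-1,1)$ with Dirichlet boundary conditions, i.e. the smallest $\lambda$ for which $(|u'|^{p-2}u')'+\lambda|u|^{p-2}u=0$ in $(-1,1)$, $u(-1)=u(1)=0$ has a nontrivial solution. It is known to be given explicitly by $$\lambda(p)=(p-1)\left(\frac{\pi}{p\sin(\pi/p)}\right)^p,$$ and this formula may be taken as the definition of $\lambda(p)$. The notation $p\to 1+0$ means that $p$ tends to $1$ from the right. *)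

theory Defs
  imports "HOL-Analysis.Analysis"
begin

text \<open>
  First Dirichlet eigenvalue of the one-dimensional \<open>p\<close>-Laplacian on \<open>(-1, 1)\<close>, given by its
  closed form.  It is meaningful for \<open>p > 1\<close> only; values at \<open>p \<le> 1\<close> carry no content.
\<close>

definition first_eigenvalue :: "real \<Rightarrow> real" where
  "first_eigenvalue p = (p - 1) * (pi / (p * sin (pi / p))) powr p"

text \<open>
  The base of the power is positive and the function is differentiable for \<open>p > 1\<close>, so
  \<open>powr\<close> and \<open>deriv\<close> have their usual meaning there.
\<close>

lemma first_eigenvalue_base_pos:
  assumes "p > 1"
  shows "pi / (p * sin (pi / p)) > 0"
proof -
  have "sin (pi / p) > 0"
    using assms by (intro sin_gt_zero) (auto simp: field_simps)
  then show ?thesis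
    using assms by simp
qed

lemma first_eigenvalue_differentiable:
  assumes "p > 1"
  shows "first_eigenvalue differentiable (at p)"
proof -
  have base: "pi / (p * sin (pi / p)) > 0"
    by (rule first_eigenvalue_base_pos[OF assms])
  then have "p * sin (pi / p) \<noteq> 0"
    by auto
  moreover have "(\<lambda>x. sin (pi / x)) differentiable (at p)"
    unfolding real_differentiable_def
    using assms by (intro exI) (auto intro!: derivative_eq_intros)
  ultimately have "(\<lambda>x. pi / (x * sin (pi / x))) differentiable (at p)"
    by (intro derivative_intros) auto
  then obtain D where D: "((\<lambda>x. pi / (x * sin (pi / x))) has_real_derivative D) (at p)"
    using real_differentiable_def by blast
  have "((\<lambda>x. (pi / (x * sin (pi / x))) powr x) has_real_derivative
      (pi / (p * sin (pi / p))) powr p *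
        (1 * ln (pi / (p * sin (pi / p))) + D * p / (pi / (p * sin (pi / p))))) (at p)"
    by (rule DERIV_powr[OF D base DERIV_ident])
  then have "(\<lambda>x. (pi / (x * sin (pi / x))) powr x) differentiable (at p)"
    using real_differentiable_def by blast
  then show ?thesis
    unfolding first_eigenvalue_def[abs_def] by (intro derivative_intros)
qed

end

theory Submission
  imports Defs "HOL-Real_Asymp.Real_Asymp"
begin

text \<open>
  Write \<open>\<lambda>(p) = (p - 1) B(p)\<^sup>p\<close> with \<open>B(p) = \<pi> / (p sin (\<pi>/p))\<close>.  Since
  \<open>B'/B = - 1/p + (\<pi>/p\<^sup>2) cot (\<pi>/p)\<close>, logarithmic differentiation gives
  \<open>\<lambda>'(p) = \<lambda>(p) (ln B + (1/(p - 1) - 1 + (\<pi>/p) cot (\<pi>/p)))\<close> (\<open>deriv_first_eigenvalue\<close>), and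
  all four limits follow from asymptotic expansions of these closed forms.

  As \<open>p\<close> decreases to \<open>1\<close>, put \<open>\<delta> = p - 1\<close>.  Then \<open>sin (\<pi>/p) = \<pi>\<delta> + O(\<delta>\<^sup>2)\<close>, so \<open>B\<close> and
  \<open>B\<^sup>p\<close> are both asymptotic to \<open>1/\<delta>\<close>, and \<open>\<lambda>(p) \<rightarrow> 1\<close>.  In the formula for
  \<open>\<lambda>'\<close> the pole of \<open>(\<pi>/p) cot (\<pi>/p)\<close> cancels that of \<open>1/(p - 1)\<close>, so the inner bracket
  stays bounded (its limit is \<open>- 1\<close>); only \<open>ln B\<close> is left to diverge, and \<open>\<lambda>'(p)\<close> grows
  like \<open>ln (1/\<delta>)\<close>.

  As \<open>p \<rightarrow> \<infinity>\<close>, put \<open>x = \<pi>/p\<close>.  Then \<open>ln B = ln (x / sin x) = x\<^sup>2/6 + O(x\<^sup>4)\<close>, so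
  \<open>B\<^sup>p = 1 + \<pi>\<^sup>2/(6p) + O(1/p\<^sup>2)\<close> and \<open>\<lambda>(p) = p + \<pi>\<^sup>2/6 - 1 + O(1/p)\<close>.  Because
  \<open>x cot x - 1 = O(x\<^sup>2)\<close>, also \<open>\<lambda>'(p) = \<lambda>(p) (1/(p - 1) + O(1/p\<^sup>2))\<close>, which tends to \<open>1\<close>.
\<close>

lemma deriv_first_eigenvalue:
  assumes p: "p > 1"
  shows "deriv first_eigenvalue p = first_eigenvalue p *
    (ln (pi / (p * sin (pi / p))) + (1 / (p - 1) - 1 + pi / p * cot (pi / p)))"
proof (rule DERIV_imp_deriv)
  let ?B = "\<lambda>x. pi / (x * sin (pi / x))"
  let ?B' = "?B p * (- 1 / p + pi / p\<^sup>2 * cot (pi / p))"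
  have s: "sin (pi / p) > 0"
    using p by (intro sin_gt_zero) (auto simp: field_simps)
  have B_pos: "?B p > 0"
    by (rule first_eigenvalue_base_pos[OF p])
  have B': "(?B has_real_derivative ?B') (at p)"
    using p s by (auto intro!: derivative_eq_intros simp: field_simps power2_eq_square cot_def)
  have powr': "((\<lambda>x. ?B x powr x) has_real_derivative
      ?B p powr p * (1 * ln (?B p) + ?B' * p / ?B p)) (at p)"
    by (rule DERIV_powr[OF B' B_pos DERIV_ident])
  have log_deriv: "?B' * p / ?B p = - 1 + pi / p * cot (pi / p)"
  proof -
    have "?B' * p / ?B p = (- 1 / p + pi / p\<^sup>2 * cot (pi / p)) * p"
      using B_pos by (metis less_irrefl mult.assoc nonzero_mult_div_cancel_left)
    also have "\<dots> = - 1 + pi / p * cot (pi / p)"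
      using p by (simp add: field_simps power2_eq_square)
    finally show ?thesis .
  qed
  have "(first_eigenvalue has_real_derivative
      ?B p powr p + (p - 1) * (?B p powr p * (ln (?B p) + (- 1 + pi / p * cot (pi / p))))) (at p)"
    unfolding first_eigenvalue_def[abs_def]
    by (rule derivative_eq_intros refl powr')+
      (unfold log_deriv, simp add: algebra_simps)
  moreover have "b + (p - 1) * (b * (l + (- 1 + c))) = (p - 1) * b * (l + (1 / (p - 1) - 1 + c))"
    for b l c :: real
    using p by (simp add: field_simps)
  ultimately show "(first_eigenvalue has_real_derivative first_eigenvalue p *
      (ln (?B p) + (1 / (p - 1) - 1 + pi / p * cot (pi / p)))) (at p)"
    by (simp only: first_eigenvalue_def[of p])
qed

lemma first_eigenvalue_tendsto_at_right_1: "(first_eigenvalue \<longlongrightarrow> 1) (at_right 1)"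
  unfolding first_eigenvalue_def[abs_def] by real_asymp

lemma deriv_first_eigenvalue_at_right_1: "filterlim (deriv first_eigenvalue) at_top (at_right 1)"
proof -
  let ?L = "\<lambda>p. ln (pi / (p * sin (pi / p)))"
  let ?R = "\<lambda>p. 1 / (p - 1) - 1 + pi / p * cot (pi / p)"
  have "\<forall>\<^sub>F p in at_right 1. deriv first_eigenvalue p = first_eigenvalue p * (?L p + ?R p)"
    using eventually_at_right_less[of "1::real"]
    by (rule eventually_mono) (rule deriv_first_eigenvalue)
  then have "filterlim (deriv first_eigenvalue) at_top (at_right 1) \<longleftrightarrow>
      filterlim (\<lambda>p. first_eigenvalue p * (?L p + ?R p)) at_top (at_right 1)"
    by (rule filterlim_cong[OF refl refl])
  moreover have "filterlim (\<lambda>p. first_eigenvalue p * (?L p + ?R p)) at_top (at_right 1)"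
  proof (rule filterlim_tendsto_pos_mult_at_top)
    show "(first_eigenvalue \<longlongrightarrow> 1) (at_right 1)"
      by (rule first_eigenvalue_tendsto_at_right_1)
    have "filterlim ?L at_top (at_right 1)"
      by real_asymp
    moreover have "(?R \<longlongrightarrow> - 1) (at_right 1)"
      unfolding cot_def by real_asymp
    ultimately have "filterlim (\<lambda>p. ?R p + ?L p) at_top (at_right 1)"
      by (intro filterlim_tendsto_add_at_top)
    then show "filterlim (\<lambda>p. ?L p + ?R p) at_top (at_right 1)"
      by (simp only: add.commute)
  qed simp
  ultimately show ?thesis by (rule iffD2)
qed

lemma first_eigenvalue_minus_id_tendsto_at_top:
  "((\<lambda>p. first_eigenvalue p - p) \<longlongrightarrow> pi\<^sup>2 / 6 - 1) at_top"
  unfolding first_eigenvalue_def[abs_def] by (real_asymp simp: field_simps power2_eq_square)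

lemma deriv_first_eigenvalue_tendsto_at_top: "(deriv first_eigenvalue \<longlongrightarrow> 1) at_top"
proof -
  let ?D = "\<lambda>p. first_eigenvalue p *
    (ln (pi / (p * sin (pi / p))) + (1 / (p - 1) - 1 + pi / p * cot (pi / p)))"
  have "\<forall>\<^sub>F p in at_top. deriv first_eigenvalue p = ?D p"
    using eventually_gt_at_top[of "1::real"]
    by (rule eventually_mono) (rule deriv_first_eigenvalue)
  then have "(deriv first_eigenvalue \<longlongrightarrow> 1) at_top \<longleftrightarrow> (?D \<longlongrightarrow> 1) at_top"
    by (rule filterlim_cong[OF refl refl])
  moreover have "(?D \<longlongrightarrow> 1) at_top"
    unfolding first_eigenvalue_def cot_def by real_asymp
  ultimately show ?thesis by (rule iffD2)
qed

theorem theorem1p6: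
  shows "(first_eigenvalue \<longlongrightarrow> 1) (at_right 1)
    \<and> filterlim (deriv first_eigenvalue) at_top (at_right 1)
    \<and> ((\<lambda>p. first_eigenvalue p - p) \<longlongrightarrow> pi\<^sup>2 / 6 - 1) at_top
    \<and> (deriv first_eigenvalue \<longlongrightarrow> 1) at_top"
  by (intro conjI first_eigenvalue_tendsto_at_right_1 deriv_first_eigenvalue_at_right_1
      first_eigenvalue_minus_id_tendsto_at_top deriv_first_eigenvalue_tendsto_at_top)

end
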